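(* Consider $c\in\mathbb{R}^d$ and $r\in\mathbb{R}$. Let $F,G\subseteq\mathbb{R}^d\times\mathbb{S}^{d\times d}$ be defined by $$ F=\{(z,M)\mid \|z-c\|\le r,\; M=zz^T\}, $$ $$ G=\left\{(z,M)\;\middle|\; \operatorname{tr}(M)-2c^Tz+c^Tc\le r^2,\quad \begin{bmatrix}M & z\\ z^T & 1\end{bmatrix}\succeq 0\right\}. $$ Then $F\subseteq G$.
   Context: $\mathbb{S}^{d\times d}$ denotes the set of real symmetric $d\times d$ matrices, $\|\cdot\|$ is the Euclidean norm, and $\succeq 0$ means positive semidefinite. *)

theory Defs
  imports "HOL-Analysis.Analysis"
begin

definition symmetric_matrices :: "(real^'n^'n) set" where
  "symmetric_matrices = {A. transpose A = A}"

definition pos_semidef :: "real^'n^'n \<Rightarrow> bool" where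
  "pos_semidef A \<longleftrightarrow> A \<in> symmetric_matrices \<and> (\<forall>x. 0 \<le> x \<bullet> (A *v x))"

text \<open>The block matrix with first block row \<open>A B\<close> and second block row \<open>C D\<close>; rows and columns
  are indexed by sum types. Recall that \<open>real^'m^'n\<close> has rows indexed by \<open>'n\<close> and columns
  by \<open>'m\<close>.\<close>

definition block_matrix ::
  "real^'m^'n \<Rightarrow> real^'q^'n \<Rightarrow> real^'m^'p \<Rightarrow> real^'q^'p \<Rightarrow> real^('m + 'q)^('n + 'p)" where
  "block_matrix A B C D = (\<chi> i j.
     (case i of
        Inl k \<Rightarrow> (case j of Inl l \<Rightarrow> A $ k $ l | Inr l \<Rightarrow> B $ k $ l)
      | Inr k \<Rightarrow> (case j of Inl l \<Rightarrow> C $ k $ l | Inr l \<Rightarrow> D $ k $ l)))"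

text \<open>The index type \<open>1\<close> has exactly one element; the type constraints select it as the width of
  the column \<open>z\<close> and the height of the row \<open>z\<^sup>T\<close>, which the library leaves polymorphic.\<close>

definition F_set :: "real^'d \<Rightarrow> real \<Rightarrow> ((real^'d) \<times> (real^'d^'d)) set" where
  "F_set c r = {(z, M). M \<in> symmetric_matrices \<and> norm (z - c) \<le> r \<and>
     M = (columnvector z :: real^1^'d) ** (rowvector z :: real^'d^1)}"

definition G_set :: "real^'d \<Rightarrow> real \<Rightarrow> ((real^'d) \<times> (real^'d^'d)) set" where
  "G_set c r = {(z, M). M \<in> symmetric_matrices \<and>
     trace M - 2 * (c \<bullet> z) + c \<bullet> c \<le> r\<^sup>2 \<and>
     pos_semidef (block_matrix M (columnvector z :: real^1^'d)
                               (rowvector z :: real^'d^1) (mat 1 :: real^1^1))}"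

end

theory Submission
  imports Defs
begin

text \<open>A point of \<open>F\<close> has the rank-one form \<open>M = z z\<^sup>T\<close>.  Since
  \<open>tr (z z\<^sup>T) = \<parallel>z\<parallel>\<^sup>2\<close>, the left-hand side of the linear constraint equals
  \<open>\<parallel>z - c\<parallel>\<^sup>2\<close>, and the bound \<open>\<parallel>z - c\<parallel> \<le> r\<close> may be squared because norms are
  nonnegative.  The block matrix is the outer product \<open>w w\<^sup>T\<close> of the lifted vector
  \<open>w = (z, 1)\<close>, and outer products are positive semidefinite because their quadratic form
  is \<open>x \<mapsto> (w \<bullet> x)\<^sup>2\<close>.\<close>

abbreviation outer :: "real^'n \<Rightarrow> real^'n^'n" where
  "outer w \<equiv> (columnvector w :: real^1^'n) ** (rowvector w :: real^'n^1)"

lemma outer_nth: "outer w $ i $ j = w $ i * w $ j"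
  by (simp add: matrix_matrix_mult_def columnvector_def rowvector_def)

lemma trace_outer: "trace (outer w) = w \<bullet> w"
  by (simp add: trace_def outer_nth inner_vec_def)

lemma outer_mult_vec: "outer w *v x = (w \<bullet> x) *\<^sub>R w"
  by (simp add: vec_eq_iff matrix_vector_mult_def outer_nth inner_vec_def
      sum_distrib_left sum_distrib_right mult_ac)

lemma pos_semidef_outer: "pos_semidef (outer w)"
proof -
  have "x \<bullet> (outer w *v x) = (w \<bullet> x)\<^sup>2" for x
    by (simp add: outer_mult_vec inner_commute power2_eq_square)
  moreover have "transpose (outer w) = outer w"
    by (simp add: vec_eq_iff transpose_def outer_nth mult.commute)
  ultimately show ?thesis
    by (simp add: pos_semidef_def symmetric_matrices_def)
qed

definition append_one :: "real^'d \<Rightarrow> real^('d + 1)" where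
  "append_one z = (\<chi> i. case i of Inl k \<Rightarrow> z $ k | Inr _ \<Rightarrow> 1)"

text \<open>The entries of \<open>(z, 1) (z, 1)\<^sup>T\<close> are \<open>z\<^sub>i z\<^sub>j\<close>, \<open>z\<^sub>i\<close>, \<open>z\<^sub>j\<close> and \<open>1\<close>, which are
  exactly the four blocks.\<close>

lemma block_matrix_outer:
  "block_matrix (outer z) (columnvector z :: real^1^'d) (rowvector z :: real^'d^1)
     (mat 1 :: real^1^1) = outer (append_one z)"
  by (auto simp: vec_eq_iff block_matrix_def matrix_matrix_mult_def append_one_def
      columnvector_def rowvector_def mat_def split: sum.split)

theorem proposition4p6:
  fixes c :: "real^'d" and r :: real
  shows "F_set c r \<subseteq> G_set c r"
proof -
  have "trace (outer z) - 2 * (c \<bullet> z) + c \<bullet> c \<le> r\<^sup>2" if "norm (z - c) \<le> r" for z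
  proof -
    have "trace (outer z) - 2 * (c \<bullet> z) + c \<bullet> c = (norm (z - c))\<^sup>2"
      by (simp add: trace_outer power2_norm_eq_inner inner_diff_left inner_diff_right
          inner_commute)
    also have "\<dots> \<le> r\<^sup>2"
      using that by (simp add: power_mono)
    finally show ?thesis .
  qed
  then show ?thesis
    by (auto simp: F_set_def G_set_def block_matrix_outer pos_semidef_outer)
qed

end
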